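(* Let $n\in\{0,1,2,\dots\}$, let $\mu\in\mathbb{C}$ with $\operatorname{Re}(\mu)>-\frac12$, and let $b\in\left(\frac{1}{\sqrt2},1\right)$. Then $$\int_{E_4} \left(\cos\phi_{E_4}(x)\right)^{2n}\left(1-\cos^2\phi_{E_4}(x)\right)^{\mu} w_{E_4}(x)\,dx = \frac{\Gamma(\frac12)\,\Gamma(\mu+\frac12)}{\Gamma(\mu+1)}\,\frac{\left(\frac12\right)_n}{(\mu+1)_n}.$$
   Context: For $b\in[\frac1{\sqrt2},1)$ put $$E_4:=[-1,-b]\cup[-\sqrt{1-b^2},\sqrt{1-b^2}]\cup[b,1].$$ For (almost every) $x\in E_4$ define $$\cos\phi_{E_4}(x):=\sqrt{\frac{(x-\sqrt{1-b^2})(x+b)}{(x+\sqrt{1-b^2})(x-b)}}\;\cdot\;\frac{(x-b)(x+\sqrt{1-b^2})}{b\sqrt{1-b^2}},$$ $$w_{E_4}(x):=\sqrt{\frac{(x-\sqrt{1-b^2})(x+b)}{(1-x^2)(x-b)(x+\sqrt{1-b^2})}}.$$ Here $\cos\phi_{E_4}$ is just the name of a real-valued function, $\cos^2\phi_{E_4}(x)$ means $(\cos\phi_{E_4}(x))^2$, and square roots of nonnegative reals are nonnegative. For $t>0$, $t^\mu=e^{\mu\log t}$ with the real logarithm. The shifted factorial is $(a)_0:=1$, $(a)_n:=a(a+1)\cdots(a+n-1)$. *)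

theory Defs
  imports "HOL-Analysis.Analysis"
begin

definition E4 :: "real \<Rightarrow> real set" where
  "E4 b = {-1..-b} \<union> {-sqrt (1 - b\<^sup>2)..sqrt (1 - b\<^sup>2)} \<union> {b..1}"

(* On E4 b both radicands below are nonnegative wherever their denominators are nonzero.
   Denominators vanish only at finitely many points, where division by zero yields 0. *)

definition cos_phi_E4 :: "real \<Rightarrow> real \<Rightarrow> real" where
  "cos_phi_E4 b x =
     sqrt (((x - sqrt (1 - b\<^sup>2)) * (x + b)) / ((x + sqrt (1 - b\<^sup>2)) * (x - b)))
       * (((x - b) * (x + sqrt (1 - b\<^sup>2))) / (b * sqrt (1 - b\<^sup>2)))"

definition w_E4 :: "real \<Rightarrow> real \<Rightarrow> real" where
  "w_E4 b x =
     sqrt (((x - sqrt (1 - b\<^sup>2)) * (x + b))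
             / ((1 - x\<^sup>2) * (x - b) * (x + sqrt (1 - b\<^sup>2))))"

(* For t > 0, complex_of_real t powr \<mu> = exp (\<mu> * ln t) with the real logarithm;
   1 - (cos_phi_E4 b x)^2 is positive on E4 b outside a finite set. *)

definition integrand_E4 :: "real \<Rightarrow> nat \<Rightarrow> complex \<Rightarrow> real \<Rightarrow> complex" where
  "integrand_E4 b n \<mu> x =
     complex_of_real (cos_phi_E4 b x) ^ (2 * n)
       * complex_of_real (1 - (cos_phi_E4 b x)\<^sup>2) powr \<mu>
       * complex_of_real (w_E4 b x)"

end

theory Submission
  imports Defs
begin

text \<open>
The function \<open>cos\<^sup>2 \<phi>\<close> pushes the measure \<open>w(x) dx\<close> on \<open>E\<^sub>4\<close> forward to the
arcsine density \<open>dt / sqrt (t (1 - t))\<close> on \<open>[0, 1]\<close>, for every \<open>b\<close> in the given range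
(\<open>distr_w_E4\<close>). The integral of the theorem is therefore the Beta integral
\<open>B(n + 1/2, \<mu> + 1/2)\<close>, and the shifted factorials are quotients of Gamma values.

To see the push-forward, let \<open>s = sqrt (1 - b\<^sup>2)\<close> and \<open>p = b s\<close>. Then
\<open>cos\<^sup>2 \<phi> = (x\<^sup>2 - s\<^sup>2) (x\<^sup>2 - b\<^sup>2) / p\<^sup>2 = 1 - x\<^sup>2 (1 - x\<^sup>2) / p\<^sup>2\<close>. This is
even in \<open>x\<close>, so only the symmetrised weight matters, and that one simplifies to
\<open>w(x) + w(-x) = 2 \<bar>x\<^sup>2 - p\<bar> / (p sqrt (1 - x\<^sup>2) \<bar>cos \<phi>\<bar>)\<close>
(\<open>w_E4_symmetrised\<close>). Each \<open>t\<close> in \<open>(0, 1)\<close> has one preimage in \<open>(b, 1)\<close> and one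
in \<open>(-s, 0)\<close>. Dividing the symmetrised weight by the derivative of \<open>cos\<^sup>2 \<phi>\<close> at these
preimages gives the arcsine density times \<open>(1 \<plusminus> (1 - 2 p) / r)\<close> divided by 2, with
\<open>r = sqrt (1 - 4 p\<^sup>2 (1 - t))\<close> (\<open>w_E4_branch\<close>). Neither contribution is an arcsine
density by itself, but the terms with \<open>r\<close> cancel in the sum (\<open>nn_integral_w_E4\<close>).

Since \<open>\<mu>\<close> is complex, the Beta integral is needed for complex exponents
(\<open>has_bochner_integral_Beta_complex\<close>). It follows from Fubini's theorem applied to the product
of two Gamma integrals.
\<close>

section \<open>The Beta integral for complex exponents\<close>

text \<open>The integrand of Euler's integral for \<open>\<Gamma>(z)\<close>, extended by zero to the
left half-line, so that a convolution of two such kernels is an integral over all of \<open>\<real>\<close>.\<close>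

definition gamma_kernel :: "complex \<Rightarrow> real \<Rightarrow> complex" where
  "gamma_kernel z t = indicator {0<..} t *\<^sub>R (of_real t powr (z - 1) / of_real (exp t))"

text \<open>The principal branch of the power jumps across the negative axis, so measurability does not follow
from continuity; on each of the three sets \<open>t < 0\<close>, \<open>t = 0\<close>, \<open>t > 0\<close> it is an explicit
expression in the real logarithm of the modulus.\<close>

lemma measurable_powr_of_real [measurable]:
  assumes [measurable]: "f \<in> borel_measurable M"
  shows "(\<lambda>t. complex_of_real (f t) powr z) \<in> borel_measurable M"
proof -
  have "(\<lambda>t. complex_of_real (f t) powr z) = (\<lambda>t. if f t = 0 then 0 else
      exp (z * (of_real (ln \<bar>f t\<bar>) + (if f t < 0 then of_real pi else 0) * \<i>)))"
    by (auto simp: powr_def Ln_of_real')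
  also have "\<dots> \<in> borel_measurable M" by measurable
  finally show ?thesis .
qed

lemma measurable_gamma_kernel [measurable]: "gamma_kernel z \<in> borel_measurable borel"
  unfolding gamma_kernel_def by measurable

lemma has_bochner_integral_gamma_kernel:
  assumes "Re z > 0"
  shows "has_bochner_integral lborel (gamma_kernel z) (Gamma z)"
proof -
  let ?f = "\<lambda>t. complex_of_real t powr (z - 1) / of_real (exp t)"
  have "integrable lebesgue (gamma_kernel z)"
    using absolutely_integrable_Gamma_integral'[OF assms]
    by (simp add: set_integrable_def gamma_kernel_def[abs_def])
  hence int: "integrable lborel (gamma_kernel z)"
    by (subst (asm) integrable_completion) auto
  hence "set_integrable lborel {0<..} ?f"
    by (simp add: set_integrable_def gamma_kernel_def[abs_def])
  from set_borel_integral_eq_integral(2)[OF this]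
  have "integral\<^sup>L lborel (gamma_kernel z) = Gamma z"
    using Gamma_integral_complex'[OF assms]
    by (simp add: set_lebesgue_integral_def gamma_kernel_def[abs_def] integral_unique)
  with int show ?thesis by (simp add: has_bochner_integral_iff)
qed

text \<open>Homogeneity: after the substitution \<open>t \<mapsto> s t\<close> the convolution integrand of the two
kernels at \<open>s\<close> separates into a function of \<open>s\<close> and a function of \<open>t\<close>.\<close>

lemma gamma_kernel_scaled:
  assumes "s > 0"
  shows "s *\<^sub>R (gamma_kernel z (s * t) * gamma_kernel w (s * (1 - t))) =
    gamma_kernel (z + w) s *
      (indicator {0<..<1} t *\<^sub>R (of_real t powr (z - 1) * of_real (1 - t) powr (w - 1)))"
proof (cases "t \<in> {0<..<1}")
  case True
  have *: "complex_of_real (x * y) powr c = of_real x powr c * of_real y powr c"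
    if "x > 0" "y > 0" for x y c
    using that by (simp add: powr_times_real)
  have "of_real s powr (z + w - 1) = of_real s * of_real s powr (z - 1) * complex_of_real s powr (w - 1)"
    using assms by (simp add: powr_add powr_diff)
  moreover have "exp (s * t) * exp (s * (1 - t)) = exp s"
    by (simp add: exp_add[symmetric] algebra_simps)
  hence "complex_of_real (exp (s * t)) * of_real (exp (s * (1 - t))) = of_real (exp s)"
    by (metis of_real_mult)
  ultimately show ?thesis using True assms *[of s t] *[of s "1 - t"]
    by (simp add: gamma_kernel_def scaleR_conv_of_real field_simps)
next
  case False
  hence "s * t \<le> 0 \<or> s * (1 - t) \<le> 0" using assms by (auto simp: mult_le_0_iff)
  with False show ?thesis by (auto simp: gamma_kernel_def)
qed

text \<open>The integral of the convolution of the kernels of \<open>z\<close> and \<open>w\<close> is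
\<open>\<Gamma>(z) \<Gamma>(w)\<close>. By homogeneity that convolution is the kernel of
\<open>z + w\<close> times the Beta integral, so the same number is \<open>\<Gamma>(z + w)\<close> times the Beta
integral. Absolute convergence, needed for the exchange of integrations, reduces to real exponents.\<close>

theorem has_bochner_integral_Beta_complex:
  assumes z: "Re z > 0" and w: "Re w > 0"
  defines "\<beta> \<equiv> \<lambda>t. indicator {0<..<1} t *\<^sub>R
    (complex_of_real t powr (z - 1) * complex_of_real (1 - t) powr (w - 1))"
  shows "has_bochner_integral lborel \<beta> (Beta z w)"
proof -
  note G = has_bochner_integral_gamma_kernel
  have zw: "Re (z + w) > 0" using z w by simp
  have meas[measurable]: "\<beta> \<in> borel_measurable borel" unfolding \<beta>_def by measurable
  have int_\<beta>: "integrable lborel \<beta>"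
  proof (rule Bochner_Integration.integrable_bound)
    show "integrable lborel (\<lambda>t. indicator {0..1} t *\<^sub>R (t powr (Re z - 1) * (1 - t) powr (Re w - 1)))"
      using integrable_Beta[OF z w] by (simp add: set_integrable_def)
    show "AE t in lborel. norm (\<beta> t) \<le>
        norm (indicator {0..1} t *\<^sub>R (t powr (Re z - 1) * (1 - t) powr (Re w - 1)))"
      by (intro AE_I2) (auto simp: \<beta>_def indicator_def norm_mult norm_powr_real_powr)
  qed simp
  have shift: "integrable lborel (\<lambda>s. gamma_kernel w (s - t))"
      "(\<integral>s. gamma_kernel w (s - t) \<partial>lborel) = Gamma w"
      "integrable lborel (\<lambda>s. norm (gamma_kernel w (s - t)))"
      "(\<integral>s. norm (gamma_kernel w (s - t)) \<partial>lborel) = (\<integral>s. norm (gamma_kernel w s) \<partial>lborel)" for t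
  proof -
    show "integrable lborel (\<lambda>s. gamma_kernel w (s - t))"
      using lborel_integrable_real_affine_iff[of 1 "gamma_kernel w" "-t"] G[OF w]
      by (simp add: has_bochner_integral_iff)
    thus "integrable lborel (\<lambda>s. norm (gamma_kernel w (s - t)))" by simp
    show "(\<integral>s. gamma_kernel w (s - t) \<partial>lborel) = Gamma w"
      using lborel_integral_real_affine[of 1 "gamma_kernel w" "-t"] G[OF w]
      by (simp add: has_bochner_integral_iff)
    show "(\<integral>s. norm (gamma_kernel w (s - t)) \<partial>lborel) = (\<integral>s. norm (gamma_kernel w s) \<partial>lborel)"
      using lborel_integral_real_affine[of 1 "\<lambda>s. norm (gamma_kernel w s)" "-t"] by simp
  qed
  have int: "integrable (lborel \<Otimes>\<^sub>M lborel) (\<lambda>(t, s). gamma_kernel z t * gamma_kernel w (s - t))"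
  proof (rule lborel_pair.Fubini_integrable)
    show "integrable lborel (\<lambda>t. \<integral>s. norm (case (t, s) of (t, s) \<Rightarrow>
        gamma_kernel z t * gamma_kernel w (s - t)) \<partial>lborel)"
      using G[OF z] by (simp add: norm_mult shift has_bochner_integral_iff)
    show "AE t in lborel. integrable lborel (\<lambda>s. case (t, s) of (t, s) \<Rightarrow>
        gamma_kernel z t * gamma_kernel w (s - t))"
      by (intro AE_I2) (simp add: shift)
  qed measurable
  have "Gamma z * Gamma w = (\<integral>t. (\<integral>s. gamma_kernel z t * gamma_kernel w (s - t) \<partial>lborel) \<partial>lborel)"
    using G[OF z] by (simp add: shift has_bochner_integral_iff)
  also have "\<dots> = (\<integral>s. (\<integral>t. gamma_kernel z t * gamma_kernel w (s - t) \<partial>lborel) \<partial>lborel)"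
    using lborel_pair.Fubini_integral[OF int] by simp
  also have "\<dots> = (\<integral>s. gamma_kernel (z + w) s * integral\<^sup>L lborel \<beta> \<partial>lborel)"
  proof (rule Bochner_Integration.integral_cong[OF refl])
    fix s :: real
    show "(\<integral>t. gamma_kernel z t * gamma_kernel w (s - t) \<partial>lborel) =
      gamma_kernel (z + w) s * integral\<^sup>L lborel \<beta>"
    proof (cases "s > 0")
      case True
      have "(\<integral>t. gamma_kernel z t * gamma_kernel w (s - t) \<partial>lborel) =
          (\<integral>t. s *\<^sub>R (gamma_kernel z (s * t) * gamma_kernel w (s * (1 - t))) \<partial>lborel)"
        using True
          lborel_integral_real_affine[of s "\<lambda>t. gamma_kernel z t * gamma_kernel w (s - t)" 0]
        by (simp add: right_diff_distrib)
      also have "\<dots> = (\<integral>t. gamma_kernel (z + w) s * \<beta> t \<partial>lborel)"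
        by (simp only: gamma_kernel_scaled[OF True] \<beta>_def)
      finally show ?thesis by simp
    next
      case False
      hence "gamma_kernel z t * gamma_kernel w (s - t) = 0" for t
        by (auto simp: gamma_kernel_def indicator_def)
      hence "(\<integral>t. gamma_kernel z t * gamma_kernel w (s - t) \<partial>lborel) = 0"
        by (simp only: Bochner_Integration.integral_zero)
      with False show ?thesis by (simp add: gamma_kernel_def)
    qed
  qed
  also have "\<dots> = Gamma (z + w) * integral\<^sup>L lborel \<beta>"
    using G[OF zw] by (simp add: has_bochner_integral_iff)
  finally have "Gamma z * Gamma w = Gamma (z + w) * integral\<^sup>L lborel \<beta>" .
  moreover have "Gamma (z + w) \<noteq> 0"
  proof
    assume "Gamma (z + w) = 0"
    then obtain n where "z + w = of_int n" "n \<le> 0"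
      by (auto simp: Gamma_eq_zero_iff elim: nonpos_Ints_cases)
    hence "Re (z + w) \<le> 0" by simp
    with zw show False by simp
  qed
  ultimately have "integral\<^sup>L lborel \<beta> = Beta z w" by (simp add: Beta_def field_simps)
  with int_\<beta> show ?thesis by (simp add: has_bochner_integral_iff)
qed

section \<open>The folded weight on the bands\<close>

lemma E4_endpoints:
  assumes "1 / sqrt 2 < b" "b < 1"
  shows "0 < sqrt (1 - b\<^sup>2)" "sqrt (1 - b\<^sup>2) < b" "(sqrt (1 - b\<^sup>2))\<^sup>2 = 1 - b\<^sup>2"
proof -
  have b0: "0 < b" using assms(1) by (smt (verit) divide_pos_pos real_sqrt_gt_zero)
  have "(1 / sqrt 2)\<^sup>2 < b\<^sup>2" by (rule power_strict_mono) (use assms in auto)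
  hence half: "1 - b\<^sup>2 < b\<^sup>2" by (simp add: power_divide)
  have "b\<^sup>2 < 1" using b0 assms(2) by (simp add: power_less_one_iff)
  thus "0 < sqrt (1 - b\<^sup>2)" "(sqrt (1 - b\<^sup>2))\<^sup>2 = 1 - b\<^sup>2" by simp_all
  from half b0 show "sqrt (1 - b\<^sup>2) < b" by (simp add: real_less_lsqrt)
qed

lemma E4_endpoint_product:
  assumes "1 / sqrt 2 < b" "b < 1"
  shows "b * sqrt (1 - b\<^sup>2) < 1 / 2"
proof -
  note s = E4_endpoints[OF assms]
  have "(b - sqrt (1 - b\<^sup>2))\<^sup>2 > 0" using s by simp
  thus ?thesis using s(3) by (simp add: power2_diff algebra_simps)
qed

text \<open>On \<open>E\<^sub>4\<close> this is \<open>cos\<^sup>2 \<phi>\<close>, with \<open>p = b * sqrt (1 - b\<^sup>2)\<close> the product of the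
two endpoints. The form chosen here makes \<open>1 - cos\<^sup>2 \<phi>\<close>, the evenness in \<open>x\<close> and the
dependence on \<open>x\<^sup>2\<close> visible.\<close>

definition cos_sq :: "real \<Rightarrow> real \<Rightarrow> real" where
  "cos_sq p x = 1 - x\<^sup>2 * (1 - x\<^sup>2) / p\<^sup>2"

lemma cos_sq_minus [simp]: "cos_sq p (-x) = cos_sq p x"
  by (simp add: cos_sq_def)

lemma cos_sq_factored:
  assumes "b\<^sup>2 + s\<^sup>2 = 1" "b \<noteq> 0" "s \<noteq> 0"
  shows "cos_sq (b * s) x = ((x - s) * (x + b)) * ((x + s) * (x - b)) / (b * s)\<^sup>2"
proof -
  have s2: "s\<^sup>2 = 1 - b\<^sup>2" using assms(1) by simp
  have "((x - s) * (x + b)) * ((x + s) * (x - b)) = (x\<^sup>2 - s\<^sup>2) * (x\<^sup>2 - b\<^sup>2)"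
    by (simp add: power2_eq_square algebra_simps)
  also have "\<dots> = (b * s)\<^sup>2 - x\<^sup>2 * (1 - x\<^sup>2)"
    by (simp add: power_mult_distrib s2) (simp add: power2_eq_square algebra_simps)
  finally show ?thesis using assms(2,3) by (simp add: cos_sq_def field_simps)
qed

text \<open>The four linear factors change sign only at \<open>\<plusminus>b\<close> and \<open>\<plusminus>s\<close>, which are
the ends of the bands, so one sign check per band suffices.\<close>

lemma E4_signs:
  fixes s b x :: real
  assumes "0 < s" "s < b" "b < 1" "x \<in> {-1..-b} \<union> {-s..s} \<union> {b..1}"
  shows "0 \<le> ((x - s) * (x + b)) / ((x + s) * (x - b))"
proof -
  consider "x \<le> -b" | "-s \<le> x" "x \<le> s" | "b \<le> x" using assms(4) by auto
  thus ?thesis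
  proof cases
    case 1
    hence "x - s \<le> 0" "x + b \<le> 0" "x + s \<le> 0" "x - b \<le> 0" using assms by auto
    thus ?thesis by (simp add: divide_nonneg_nonneg mult_nonpos_nonpos)
  next
    case 2
    hence "x - s \<le> 0" "x + b \<ge> 0" "x + s \<ge> 0" "x - b \<le> 0" using assms by auto
    thus ?thesis by (simp add: divide_nonpos_nonpos mult_nonneg_nonpos mult_nonpos_nonneg)
  next
    case 3
    hence "x - s \<ge> 0" "x + b \<ge> 0" "x + s \<ge> 0" "x - b \<ge> 0" using assms by auto
    thus ?thesis by simp
  qed
qed

lemma cos_phi_E4_squared:
  assumes b: "1 / sqrt 2 < b" "b < 1" and x: "x \<in> E4 b"
  shows "(cos_phi_E4 b x)\<^sup>2 = cos_sq (b * sqrt (1 - b\<^sup>2)) x"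
proof -
  define s where "s = sqrt (1 - b\<^sup>2)"
  note s = E4_endpoints[OF b, folded s_def]
  define A B where "A = (x - s) * (x + b)" and "B = (x + s) * (x - b)"
  have "0 \<le> A / B" unfolding A_def B_def
    using s b x by (intro E4_signs) (auto simp: E4_def s_def)
  hence "(sqrt (A / B) * (B / (b * s)))\<^sup>2 = A / B * B\<^sup>2 / (b * s)\<^sup>2"
    by (simp add: power_mult_distrib power_divide)
  also have "\<dots> = A * B / (b * s)\<^sup>2" by (simp add: power2_eq_square)
  also have "\<dots> = cos_sq (b * s) x" unfolding A_def B_def
    using s b by (subst cos_sq_factored) auto
  finally show ?thesis unfolding A_def B_def
    by (simp add: cos_phi_E4_def s_def mult.commute)
qed

lemma w_E4_nonneg:
  assumes b: "1 / sqrt 2 < b" "b < 1" and x: "x \<in> E4 b"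
  shows "0 \<le> w_E4 b x"
proof -
  define s where "s = sqrt (1 - b\<^sup>2)"
  note s = E4_endpoints[OF b, folded s_def]
  have "0 \<le> ((x - s) * (x + b)) / ((x + s) * (x - b))"
    using s b x by (intro E4_signs) (auto simp: E4_def s_def)
  moreover have "0 \<le> 1 - x\<^sup>2" using x s b by (auto simp: E4_def s_def[symmetric] abs_square_le_1 abs_le_iff)
  ultimately have "0 \<le> ((x - s) * (x + b)) / ((x + s) * (x - b)) / (1 - x\<^sup>2)" by (rule divide_nonneg_nonneg)
  also have "\<dots> = ((x - s) * (x + b)) / ((1 - x\<^sup>2) * (x - b) * (x + s))"
    by (simp add: mult_ac)
  finally show ?thesis by (simp add: w_E4_def s_def)
qed

lemma sqrt_ratio:
  fixes A B D :: real
  assumes "A * B > 0" "D > 0"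
  shows "sqrt (A / (D * B)) = \<bar>A\<bar> / (sqrt D * sqrt (A * B))"
proof -
  have "A / (D * B) = A\<^sup>2 / (D * (A * B))" using assms by (auto simp: power2_eq_square field_simps)
  thus ?thesis by (simp add: real_sqrt_divide real_sqrt_mult)
qed

text \<open>With \<open>A = (x - s) (x + b)\<close> and \<open>B = (x + s) (x - b)\<close>, the reflection \<open>x \<mapsto> -x\<close>
exchanges \<open>A\<close> and \<open>B\<close>. Both values of the weight have the common denominator
\<open>sqrt (1 - x\<^sup>2) * sqrt (A * B)\<close>, where \<open>A * B = p\<^sup>2 * cos\<^sup>2 \<phi>\<close>, and the numerators add up
to \<open>\<bar>A + B\<bar>\<close> because \<open>A\<close> and \<open>B\<close> have the same sign.\<close>

lemma w_E4_symmetrised: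
  assumes b: "1 / sqrt 2 < b" "b < 1"
    and pos: "0 < cos_sq (b * sqrt (1 - b\<^sup>2)) x" "x\<^sup>2 < 1"
  defines "p \<equiv> b * sqrt (1 - b\<^sup>2)"
  shows "w_E4 b x + w_E4 b (-x) = 2 * \<bar>x\<^sup>2 - p\<bar> / (p * sqrt (1 - x\<^sup>2) * sqrt (cos_sq p x))"
proof -
  define s where "s = sqrt (1 - b\<^sup>2)"
  note s = E4_endpoints[OF b, folded s_def]
  have p: "p = b * s" "p > 0" using s by (simp_all add: p_def flip: s_def)
  define A B D where "A = (x - s) * (x + b)" and "B = (x + s) * (x - b)" and "D = 1 - x\<^sup>2"
  have AB: "A * B = p\<^sup>2 * cos_sq p x" unfolding A_def B_def p(1)
    using s b by (subst cos_sq_factored) auto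
  have D: "D > 0" using pos by (simp add: D_def)
  have AB0: "A * B > 0" using pos(1) p(2) unfolding AB by (simp flip: p_def)
  have sq: "sqrt (A * B) = p * sqrt (cos_sq p x)" using p by (simp add: AB real_sqrt_mult)
  have "w_E4 b x = sqrt (A / (D * B))"
    by (simp add: w_E4_def A_def B_def D_def s_def mult_ac)
  moreover have "w_E4 b (-x) = sqrt (B / (D * A))"
  proof -
    have "B = (- x - s) * (- x + b)" "(1 - (- x)\<^sup>2) * (- x - b) * (- x + s) = D * A"
      by (simp_all add: A_def B_def D_def algebra_simps)
    thus ?thesis by (simp add: w_E4_def s_def)
  qed
  ultimately have "w_E4 b x + w_E4 b (-x) = (\<bar>A\<bar> + \<bar>B\<bar>) / (sqrt D * sqrt (A * B))"
    using sqrt_ratio[of A B D] sqrt_ratio[of B A D] AB0 D by (simp add: add_divide_distrib mult.commute)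
  also have "\<bar>A\<bar> + \<bar>B\<bar> = \<bar>A + B\<bar>" using AB0 by (auto simp: zero_less_mult_iff)
  also have "A + B = 2 * (x\<^sup>2 - p)" by (simp add: A_def B_def p algebra_simps power2_eq_square)
  also have "\<bar>2 * (x\<^sup>2 - p)\<bar> = 2 * \<bar>x\<^sup>2 - p\<bar>" by (simp only: abs_mult abs_numeral)
  finally show ?thesis by (simp add: sq D_def mult_ac)
qed

text \<open>The equation \<open>cos_sq p x = t\<close> is quadratic in \<open>x\<^sup>2\<close>, with roots
\<open>(1 \<plusminus> r) / 2\<close>, where \<open>r = sqrt (1 - 4 p\<^sup>2 (1 - t))\<close>. The root with the plus sign lies
in the outer bands, the other one in the central band. The share with \<open>\<epsilon> = 1\<close> is the
fraction of the arcsine density \<open>1 / sqrt (t (1 - t))\<close> at \<open>t\<close> that comes from the outer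
bands, and the share with \<open>\<epsilon> = -1\<close> is the fraction from the central band.\<close>

definition branch_share :: "real \<Rightarrow> real \<Rightarrow> real \<Rightarrow> real" where
  "branch_share \<epsilon> p t = (1 + \<epsilon> * (1 - 2 * p) / sqrt (1 - 4 * p\<^sup>2 * (1 - t))) / 2"

text \<open>The condition \<open>p < 1/2\<close> gives \<open>r\<^sup>2 \<ge> (1 - 2 p)\<^sup>2\<close>, so the correction
\<open>(1 - 2 p) / r\<close> is at most 1.\<close>

lemma branch_share_nonneg:
  assumes "0 < p" "p < 1 / 2" "0 \<le> t" "\<bar>\<epsilon>\<bar> = 1"
  shows "0 \<le> branch_share \<epsilon> p t"
proof -
  have "p * (2 * p) \<le> p * 1" using assms by (intro mult_left_mono) auto
  moreover have "0 \<le> p * (p * t)" using assms by simp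
  ultimately have le: "(1 - 2 * p)\<^sup>2 \<le> 1 - 4 * p\<^sup>2 * (1 - t)"
    by (simp add: power2_eq_square algebra_simps)
  hence "1 - 2 * p \<le> sqrt (1 - 4 * p\<^sup>2 * (1 - t))" by (rule real_le_rsqrt)
  moreover have "0 < 1 - 2 * p" using assms by simp
  ultimately have "(1 - 2 * p) / sqrt (1 - 4 * p\<^sup>2 * (1 - t)) \<le> 1" 
      "0 \<le> (1 - 2 * p) / sqrt (1 - 4 * p\<^sup>2 * (1 - t))"
    by (auto simp only: divide_le_eq_1 intro!: divide_nonneg_pos)
  moreover have "\<epsilon> = 1 \<or> \<epsilon> = -1" using assms(4) by auto
  ultimately show ?thesis by (auto simp: branch_share_def minus_divide_left simp del: minus_divide_left[symmetric] minus_diff_eq)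
qed

text \<open>On each of the half bands \<open>(b, 1)\<close> and \<open>(-s, 0)\<close> the symmetrised weight is a function of
\<open>t = cos_sq p x\<close> times the derivative of \<open>cos_sq p\<close>, so it is ready for substitution.
The root \<open>r\<close> in the share becomes \<open>\<epsilon> (2 x\<^sup>2 - 1)\<close>, and the share becomes the ratio
\<open>(x\<^sup>2 - p) / (2 x\<^sup>2 - 1)\<close> of the weight to the derivative, up to the arcsine factor. The left
half of the central band is used because \<open>cos_sq p\<close> increases from 0 to 1 there, as it does on
\<open>[b, 1]\<close>.\<close>

lemma w_E4_branch:
  assumes b: "1 / sqrt 2 < b" "b < 1"
  defines "s \<equiv> sqrt (1 - b\<^sup>2)"
  defines "p \<equiv> b * s"
  assumes x: "b < x \<and> x < 1 \<and> \<epsilon> = 1 \<or> -s < x \<and> x < 0 \<and> \<epsilon> = -1"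
  shows "w_E4 b x + w_E4 b (-x) = branch_share \<epsilon> p (cos_sq p x) / sqrt (cos_sq p x * (1 - cos_sq p x))
           * (2 * x * (2 * x\<^sup>2 - 1) / p\<^sup>2)"
proof -
  note s = E4_endpoints[OF b, folded s_def]
  have p: "p > 0" using s by (auto simp: p_def)
  have bb: "s\<^sup>2 < b\<^sup>2" using s by (intro power_strict_mono) auto
  have ps: "s\<^sup>2 < p" "p < b\<^sup>2"
    using s(1,2) unfolding p_def power2_eq_square by simp_all
  have T0: "0 < cos_sq p x"
  proof -
    have "0 < ((x - s) * (x + b)) * ((x + s) * (x - b))"
    proof (cases "x < 0")
      case True
      thus ?thesis using s x b by (intro mult_neg_neg mult_neg_pos mult_pos_neg) auto
    next
      case False
      thus ?thesis using s x b by (intro mult_pos_pos) auto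
    qed
    thus ?thesis unfolding p_def using s b by (subst cos_sq_factored) auto
  qed
  have x2: "x\<^sup>2 < 1" using x s b by (auto simp: abs_square_less_1)
  \<comment> \<open>The sign \<open>\<epsilon>\<close> removes all absolute values on both half bands at once.\<close>
  have xx: "\<bar>x\<^sup>2 - p\<bar> = \<epsilon> * (x\<^sup>2 - p)"
    "\<bar>2 * x\<^sup>2 - 1\<bar> = \<epsilon> * (2 * x\<^sup>2 - 1)"
    "2 * x\<^sup>2 - 1 \<noteq> 0"
    "\<bar>x\<bar> = \<epsilon> * x" "\<epsilon> * \<epsilon> = 1" "x \<noteq> 0"
  proof -
    have "b < x \<Longrightarrow> b\<^sup>2 < x\<^sup>2" using s by (intro power_strict_mono) auto
    moreover have "-s < x \<Longrightarrow> x < 0 \<Longrightarrow> x\<^sup>2 < s\<^sup>2" using s by (intro power2_strict_mono) auto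
    ultimately show "\<bar>x\<^sup>2 - p\<bar> = \<epsilon> * (x\<^sup>2 - p)"
      "\<bar>2 * x\<^sup>2 - 1\<bar> = \<epsilon> * (2 * x\<^sup>2 - 1)"
      "2 * x\<^sup>2 - 1 \<noteq> 0"
      "\<bar>x\<bar> = \<epsilon> * x" "\<epsilon> * \<epsilon> = 1" "x \<noteq> 0"
      using x ps bb s b by auto
  qed
  have "1 - 4 * p\<^sup>2 * (1 - cos_sq p x) = (2 * x\<^sup>2 - 1)\<^sup>2"
    using p by (simp add: cos_sq_def) (simp add: power2_eq_square algebra_simps)
  hence root: "sqrt (1 - 4 * p\<^sup>2 * (1 - cos_sq p x)) = \<epsilon> * (2 * x\<^sup>2 - 1)" using xx by simp
  hence share: "branch_share \<epsilon> p (cos_sq p x) = (x\<^sup>2 - p) / (2 * x\<^sup>2 - 1)"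
  proof -
    have "branch_share \<epsilon> p (cos_sq p x) = (1 + \<epsilon> * (1 - 2 * p) / (\<epsilon> * (2 * x\<^sup>2 - 1))) / 2"
      unfolding branch_share_def root ..
    also have "\<dots> = (1 + (1 - 2 * p) / (2 * x\<^sup>2 - 1)) / 2" using xx(5) by auto
    also have "\<dots> = (x\<^sup>2 - p) / (2 * x\<^sup>2 - 1)" using xx(3) by (simp add: field_simps)
    finally show ?thesis .
  qed
  have "1 - cos_sq p x = x\<^sup>2 * (1 - x\<^sup>2) / p\<^sup>2" by (simp add: cos_sq_def)
  hence ker: "sqrt (cos_sq p x * (1 - cos_sq p x)) = sqrt (cos_sq p x) * (\<epsilon> * x * sqrt (1 - x\<^sup>2) / p)"
    using p xx(4) by (simp add: real_sqrt_mult real_sqrt_divide)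
  have lhs: "w_E4 b x + w_E4 b (-x) = 2 * (\<epsilon> * (x\<^sup>2 - p)) / (p * sqrt (1 - x\<^sup>2) * sqrt (cos_sq p x))"
    using w_E4_symmetrised[OF b, of x] T0 x2 xx(1) by (simp add: p_def s_def)
  have alg: "2 * (\<epsilon> * u) / (p * D * C) = (u / v) / (C * (\<epsilon> * x * D / p)) * (2 * x * v / p\<^sup>2)"
    if "v \<noteq> 0" "D \<noteq> 0" "C \<noteq> 0" for u v C D :: real
    using that p xx(6) x by (auto simp: field_simps power2_eq_square)
  show ?thesis unfolding lhs share ker
    by (rule alg) (use xx T0 x2 in auto)
qed

section \<open>The image of the weight is the arcsine density\<close>

lemma E4_uminus_iff: "-x \<in> E4 b \<longleftrightarrow> x \<in> E4 b"
  by (auto simp: E4_def)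

lemma measurable_cos_sq [measurable]: "cos_sq p \<in> borel_measurable borel"
  unfolding cos_sq_def[abs_def] by measurable

lemma measurable_w_E4 [measurable]: "w_E4 b \<in> borel_measurable borel"
  unfolding w_E4_def[abs_def] by measurable

lemma measurable_branch_share [measurable]: "branch_share \<epsilon> p \<in> borel_measurable borel"
  unfolding branch_share_def[abs_def] by measurable

lemma has_real_derivative_cos_sq:
  "(cos_sq p has_real_derivative (2 * x * (2 * x\<^sup>2 - 1) / p\<^sup>2)) (at x)"
  unfolding cos_sq_def[abs_def]
  by (cases "p = 0") (auto intro!: derivative_eq_intros simp: field_simps power2_eq_square)

lemma cos_sq_endpoints:
  assumes b: "1 / sqrt 2 < b" "b < 1"
  defines "s \<equiv> sqrt (1 - b\<^sup>2)"
  shows "cos_sq (b * s) b = 0" "cos_sq (b * s) (-s) = 0" "cos_sq (b * s) 1 = 1" "cos_sq (b * s) 0 = 1"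
proof -
  note s = E4_endpoints[OF b, folded s_def]
  show "cos_sq (b * s) b = 0" "cos_sq (b * s) (-s) = 0"
    using s by (simp_all add: cos_sq_factored)
  show "cos_sq (b * s) 1 = 1" "cos_sq (b * s) 0 = 1" by (simp_all add: cos_sq_def)
qed

text \<open>Substitution of \<open>t = cos_sq p x\<close> on one half band \<open>[lo, hi]\<close>, which this function maps
increasingly onto \<open>[0, 1]\<close>. The endpoints, at
which the pointwise identity may fail because of the singularities of the weight, form a null set.\<close>

lemma nn_integral_branch:
  fixes F :: "real \<Rightarrow> ennreal"
  assumes b: "1 / sqrt 2 < b" "b < 1"
  assumes F [measurable]: "F \<in> borel_measurable borel"
  defines "s \<equiv> sqrt (1 - b\<^sup>2)"
  defines "p \<equiv> b * s"
  assumes branch: "lo = b \<and> hi = 1 \<and> \<epsilon> = 1 \<or> lo = -s \<and> hi = 0 \<and> \<epsilon> = -1"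
  shows "(\<integral>\<^sup>+x. F (cos_sq p x) * (ennreal (w_E4 b x) + ennreal (w_E4 b (-x))) * indicator {lo..hi} x \<partial>lborel)
    = (\<integral>\<^sup>+t. F t * ennreal (branch_share \<epsilon> p t / sqrt (t * (1 - t))) * indicator {0..1} t \<partial>lborel)"
proof -
  note s = E4_endpoints[OF b, folded s_def]
  have p: "p > 0" using s by (auto simp: p_def)
  have p2: "p < 1 / 2" using E4_endpoint_product[OF b] by (simp add: p_def s_def)
  have ends: "cos_sq p lo = 0" "cos_sq p hi = 1"
    using cos_sq_endpoints[OF b] branch by (auto simp: p_def s_def)
  let ?T' = "\<lambda>x. 2 * x * (2 * x\<^sup>2 - 1) / p\<^sup>2"
  let ?k = "\<lambda>t. branch_share \<epsilon> p t / sqrt (t * (1 - t))"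
  have T'_nonneg: "0 \<le> ?T' x" if x: "x \<in> {lo..hi}" for x
  proof -
    from branch have "0 \<le> x * (2 * x\<^sup>2 - 1)"
    proof
      assume "lo = b \<and> hi = 1 \<and> \<epsilon> = 1"
      with x s have "b\<^sup>2 \<le> x\<^sup>2" "0 \<le> x" by (auto intro: power_mono)
      moreover have "s\<^sup>2 < b\<^sup>2" using s by (intro power_strict_mono) auto
      ultimately show ?thesis using s(3) by (intro mult_nonneg_nonneg) auto
    next
      assume "lo = -s \<and> hi = 0 \<and> \<epsilon> = -1"
      with x s have "\<bar>x\<bar> \<le> \<bar>s\<bar>" "x \<le> 0" by auto
      hence "x\<^sup>2 \<le> s\<^sup>2" by (simp only: abs_le_square_iff)
      moreover have "s\<^sup>2 < b\<^sup>2" using s by (intro power_strict_mono) auto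
      ultimately show ?thesis using s(3) \<open>x \<le> 0\<close> by (intro mult_nonpos_nonpos) auto
    qed
    thus ?thesis by (simp add: mult.assoc)
  qed
  have "(\<integral>\<^sup>+x. F (cos_sq p x) * (ennreal (w_E4 b x) + ennreal (w_E4 b (-x))) * indicator {lo..hi} x \<partial>lborel)
    = (\<integral>\<^sup>+x. F (cos_sq p x) * ennreal (?k (cos_sq p x)) * ennreal (?T' x) * indicator {lo..hi} x \<partial>lborel)"
  proof (rule nn_integral_cong_AE)
    show "AE x in lborel. F (cos_sq p x) * (ennreal (w_E4 b x) + ennreal (w_E4 b (-x))) * indicator {lo..hi} x
      = F (cos_sq p x) * ennreal (?k (cos_sq p x)) * ennreal (?T' x) * indicator {lo..hi} x"
      using AE_lborel_singleton[of lo] AE_lborel_singleton[of hi]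
    proof eventually_elim
      case (elim x)
      show ?case
      proof (cases "x \<in> {lo..hi}")
        case True
        have inner: "b < x \<and> x < 1 \<and> \<epsilon> = 1 \<or> -s < x \<and> x < 0 \<and> \<epsilon> = -1"
          using branch True elim by auto
        hence xE: "x \<in> E4 b" using s b by (auto simp: E4_def simp flip: s_def)
        have T: "0 \<le> cos_sq p x"
          using cos_phi_E4_squared[OF b xE] by (metis p_def s_def zero_le_power2)
        have "\<bar>x\<bar> \<le> 1" using inner s b by auto
        hence "0 \<le> 1 - cos_sq p x" by (simp add: cos_sq_def abs_square_le_1)
        hence k: "0 \<le> ?k (cos_sq p x)"
          using T p p2 inner by (intro divide_nonneg_nonneg branch_share_nonneg) auto
        have "ennreal (w_E4 b x) + ennreal (w_E4 b (-x)) = ennreal (w_E4 b x + w_E4 b (-x))"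
          using w_E4_nonneg[OF b] xE by (simp add: E4_uminus_iff)
        also have "w_E4 b x + w_E4 b (-x) = ?k (cos_sq p x) * ?T' x"
          using w_E4_branch[OF b, of x \<epsilon>] inner unfolding p_def s_def by blast
        also have "ennreal \<dots> = ennreal (?k (cos_sq p x)) * ennreal (?T' x)"
          using k T'_nonneg[OF True] by (rule ennreal_mult)
        finally show ?thesis by (simp add: mult.assoc)
      qed simp
    qed
  qed
  also have "\<dots> = (\<integral>\<^sup>+t. F t * ennreal (?k t) * indicator {cos_sq p lo..cos_sq p hi} t \<partial>lborel)"
  proof (rule nn_integral_substitution_aux[symmetric, where f = "\<lambda>t. F t * ennreal (?k t)"])
    show "lo < hi" using branch s b by auto
    show "continuous_on {lo..hi} ?T'" using p by (intro continuous_intros) auto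
  qed (use T'_nonneg has_real_derivative_cos_sq in auto)
  finally show ?thesis by (simp add: ends)
qed

lemma branch_shares_sum: "branch_share 1 p t + branch_share (-1) p t = 1"
  by (simp add: branch_share_def add_divide_distrib[symmetric] minus_divide_left)

text \<open>Reflection folds \<open>E\<^sub>4\<close> onto \<open>[b, 1]\<close> and \<open>[-s, 0]\<close>, and the two half bands
contribute complementary shares of the arcsine density.\<close>

lemma nn_integral_w_E4:
  fixes F :: "real \<Rightarrow> ennreal"
  assumes b: "1 / sqrt 2 < b" "b < 1"
  assumes F [measurable]: "F \<in> borel_measurable borel"
  defines "p \<equiv> b * sqrt (1 - b\<^sup>2)"
  shows "(\<integral>\<^sup>+x. F (cos_sq p x) * ennreal (w_E4 b x) * indicator (E4 b) x \<partial>lborel)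
    = (\<integral>\<^sup>+t. F t * ennreal (1 / sqrt (t * (1 - t))) * indicator {0..1} t \<partial>lborel)"
proof -
  define s where "s = sqrt (1 - b\<^sup>2)"
  note s = E4_endpoints[OF b, folded s_def]
  have p: "p > 0" "p = b * s" using s by (simp_all add: p_def flip: s_def)
  have p2: "p < 1 / 2" using E4_endpoint_product[OF b] by (simp add: p_def)
  let ?h = "\<lambda>x. F (cos_sq p x) * ennreal (w_E4 b x)"
  let ?sym = "\<lambda>x. F (cos_sq p x) * (ennreal (w_E4 b x) + ennreal (w_E4 b (-x)))"
  have fold: "(\<integral>\<^sup>+x. ?h x * indicator I x + ?h x * indicator I (-x) \<partial>lborel)
      = (\<integral>\<^sup>+x. ?sym x * indicator I x \<partial>lborel)" if [measurable]: "I \<in> sets borel" for I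
  proof -
    have "(\<integral>\<^sup>+x. ?h x * indicator I (-x) \<partial>lborel) = (\<integral>\<^sup>+x. ?h (-x) * indicator I x \<partial>lborel)"
      using nn_integral_real_affine[of "\<lambda>x. ?h x * indicator I (-x)" "-1" 0] by simp
    hence "(\<integral>\<^sup>+x. ?h x * indicator I x + ?h x * indicator I (-x) \<partial>lborel)
        = (\<integral>\<^sup>+x. ?h x * indicator I x + ?h (-x) * indicator I x \<partial>lborel)"
      by (simp add: nn_integral_add)
    thus ?thesis by (simp add: distrib_left distrib_right)
  qed
  have "(\<integral>\<^sup>+x. ?h x * indicator (E4 b) x \<partial>lborel)
      = (\<integral>\<^sup>+x. (?h x * indicator {b..1} x + ?h x * indicator {b..1} (-x))
              + (?h x * indicator {-s..0} x + ?h x * indicator {-s..0} (-x)) \<partial>lborel)"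
  proof (rule nn_integral_cong_AE)
  \<comment> \<open>At \<open>x = 0\<close> the two halves of the central band overlap.\<close>
    show "AE x in lborel. ?h x * indicator (E4 b) x
      = (?h x * indicator {b..1} x + ?h x * indicator {b..1} (-x))
        + (?h x * indicator {-s..0} x + ?h x * indicator {-s..0} (-x))"
      using AE_lborel_singleton[of 0]
    proof eventually_elim
      case (elim x)
      thus ?case using s b by (auto simp: E4_def indicator_def simp flip: s_def)
    qed
  qed
  also have "\<dots> = (\<integral>\<^sup>+x. ?sym x * indicator {b..1} x \<partial>lborel) + (\<integral>\<^sup>+x. ?sym x * indicator {-s..0} x \<partial>lborel)"
    by (subst nn_integral_add, measurable) (intro arg_cong2[where f = "(+)"] fold; simp)
  also have "\<dots> = (\<integral>\<^sup>+t. F t * ennreal (branch_share 1 p t / sqrt (t * (1 - t))) * indicator {0..1} t \<partial>lborel)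
      + (\<integral>\<^sup>+t. F t * ennreal (branch_share (-1) p t / sqrt (t * (1 - t))) * indicator {0..1} t \<partial>lborel)"
    using nn_integral_branch[OF b F, of b 1 1] nn_integral_branch[OF b F, of "-s" 0 "-1"]
    by (simp add: p s_def)
  also have "\<dots> = (\<integral>\<^sup>+t. F t * ennreal (branch_share 1 p t / sqrt (t * (1 - t))) * indicator {0..1} t
      + F t * ennreal (branch_share (-1) p t / sqrt (t * (1 - t))) * indicator {0..1} t \<partial>lborel)"
    by (rule nn_integral_add[symmetric]) measurable
  also have "\<dots> = (\<integral>\<^sup>+t. F t * ennreal (1 / sqrt (t * (1 - t))) * indicator {0..1} t \<partial>lborel)"
  proof (rule nn_integral_cong)
    fix t :: real
    show "F t * ennreal (branch_share 1 p t / sqrt (t * (1 - t))) * indicator {0..1} t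
      + F t * ennreal (branch_share (-1) p t / sqrt (t * (1 - t))) * indicator {0..1} t
      = F t * ennreal (1 / sqrt (t * (1 - t))) * indicator {0..1} t"
    proof (cases "t \<in> {0..1}")
      case True
      hence "ennreal (branch_share 1 p t / sqrt (t * (1 - t)))
          + ennreal (branch_share (-1) p t / sqrt (t * (1 - t)))
        = ennreal (branch_share 1 p t / sqrt (t * (1 - t)) + branch_share (-1) p t / sqrt (t * (1 - t)))"
        using p p2 by (intro ennreal_plus[symmetric] divide_nonneg_nonneg branch_share_nonneg) auto
      thus ?thesis using True branch_shares_sum[of p t]
        by (simp flip: distrib_left add_divide_distrib)
    qed simp
  qed
  finally show ?thesis .
qed

lemma sets_E4 [measurable]: "E4 b \<in> sets borel"
  unfolding E4_def by simp

text \<open>The same fact as an equality of measures: this form transfers integrals of vector-valued functions,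
together with their integrability.\<close>

lemma distr_w_E4:
  assumes b: "1 / sqrt 2 < b" "b < 1"
  defines "p \<equiv> b * sqrt (1 - b\<^sup>2)"
  shows "distr (density lborel (\<lambda>x. indicator (E4 b) x * w_E4 b x)) borel (cos_sq p)
    = density lborel (\<lambda>t. indicator {0..1} t / sqrt (t * (1 - t)))" (is "?M = ?N")
proof (rule measure_eqI)
  fix A assume "A \<in> sets ?M"
  hence A [measurable]: "A \<in> sets borel" by simp
  have "emeasure ?M A = (\<integral>\<^sup>+x. indicator A (cos_sq p x) * ennreal (w_E4 b x) * indicator (E4 b) x \<partial>lborel)"
    by (subst emeasure_distr, measurable, subst emeasure_density)
       (auto intro!: nn_integral_cong measurable_sets_borel[OF measurable_cos_sq] simp: indicator_def)
  also have "\<dots> = (\<integral>\<^sup>+t. indicator A t * ennreal (1 / sqrt (t * (1 - t))) * indicator {0..1} t \<partial>lborel)"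
    unfolding p_def by (rule nn_integral_w_E4[OF b]) measurable
  also have "\<dots> = emeasure ?N A"
    by (subst emeasure_density) (auto intro!: nn_integral_cong simp: indicator_def)
  finally show "emeasure ?M A = emeasure ?N A" .
qed simp

lemma has_bochner_integral_w_E4:
  fixes H :: "real \<Rightarrow> complex"
  assumes b: "1 / sqrt 2 < b" "b < 1"
  assumes H [measurable]: "H \<in> borel_measurable borel"
  assumes int: "has_bochner_integral lborel (\<lambda>t. (indicator {0..1} t / sqrt (t * (1 - t))) *\<^sub>R H t) I"
  defines "p \<equiv> b * sqrt (1 - b\<^sup>2)"
  shows "has_bochner_integral lborel (\<lambda>x. (indicator (E4 b) x * w_E4 b x) *\<^sub>R H (cos_sq p x)) I"
proof -
  have nn: "AE x in lborel. 0 \<le> indicator (E4 b) x * w_E4 b x"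
      "AE t in lborel. 0 \<le> indicator {0..1} t / sqrt (t * (1 - t))"
    using w_E4_nonneg[OF b] by (auto simp: indicator_def)
  note eq = distr_w_E4[OF b, folded p_def]
  have "has_bochner_integral (density lborel (\<lambda>t. indicator {0..1} t / sqrt (t * (1 - t)))) H I"
    using int nn(2) by (simp add: has_bochner_integral_iff integrable_density integral_density)
  hence "has_bochner_integral (distr (density lborel (\<lambda>x. indicator (E4 b) x * w_E4 b x)) borel (cos_sq p)) H I"
    by (simp only: eq)
  thus ?thesis using nn(1)
    by (simp add: has_bochner_integral_iff integrable_distr_eq integral_distr integrable_density integral_density)
qed

section \<open>Evaluation of the integral\<close>

theorem theorem3p1:
  fixes n :: nat and \<mu> :: complex and b :: real
  assumes "Re \<mu> > - 1 / 2"
    and "1 / sqrt 2 < b" and "b < 1"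
  shows "set_integrable lborel (E4 b) (integrand_E4 b n \<mu>) \<and>
    (LINT x:E4 b|lborel. integrand_E4 b n \<mu> x) =
      Gamma (1 / 2) * Gamma (\<mu> + 1 / 2) / Gamma (\<mu> + 1)
        * (pochhammer (1 / 2) n / pochhammer (\<mu> + 1) n)"
proof -
  note b = assms(2,3)
  define p where "p = b * sqrt (1 - b\<^sup>2)"
  define H where "H t = complex_of_real t ^ n * complex_of_real (1 - t) powr \<mu>" for t
  define z w where "z = complex_of_nat n + 1 / 2" and "w = \<mu> + 1 / 2"
  have Re: "Re z > 0" "Re w > 0" using assms(1) by (simp_all add: z_def w_def)
  have H [measurable]: "H \<in> borel_measurable borel" unfolding H_def[abs_def] by measurable
  \<comment> \<open>After the transfer to \<open>t = cos\<^sup>2 \<phi>\<close>, the arcsine density lowers both exponents of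
    \<open>t\<^sup>n (1 - t)\<^sup>\<mu>\<close> by \<open>1/2\<close>.\<close>
  have kernel: "(indicator {0..1} t / sqrt (t * (1 - t))) *\<^sub>R H t = indicator {0<..<1} t *\<^sub>R
      (complex_of_real t powr (z - 1) * complex_of_real (1 - t) powr (w - 1))" for t
  proof (cases "t \<in> {0<..<1}")
    case True
    have half: "complex_of_real x powr (- (1 / 2)) = inverse (of_real (sqrt x))" if "x > 0" for x
    proof -
      have "complex_of_real x powr (of_real (1 / 2)) = of_real (x powr (1 / 2))"
        using that by (intro powr_of_real) simp
      hence "complex_of_real x powr (1 / 2) = of_real (sqrt x)"
        using that by (simp add: powr_half_sqrt)
      thus ?thesis by (simp only: powr_minus)
    qed
    have "complex_of_real t powr (z - 1) = complex_of_real t powr of_nat n * of_real t powr (- (1 / 2))"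
      by (simp add: z_def flip: powr_add)
    also have "\<dots> = of_real t ^ n * inverse (of_real (sqrt t))"
      using True by (subst half) (simp_all add: powr_nat')
    finally have 1: "complex_of_real t powr (z - 1) = of_real t ^ n * inverse (of_real (sqrt t))" .
    have "complex_of_real (1 - t) powr (w - 1)
        = complex_of_real (1 - t) powr \<mu> * complex_of_real (1 - t) powr (- (1 / 2))"
      by (simp add: w_def flip: powr_add)
    also have "\<dots> = of_real (1 - t) powr \<mu> * inverse (of_real (sqrt (1 - t)))"
      using True by (subst half) simp_all
    finally show ?thesis using True 1
      by (simp add: H_def scaleR_conv_of_real real_sqrt_mult divide_inverse mult_ac)
  qed (auto simp: indicator_def)
  have "has_bochner_integral lborel (\<lambda>t. (indicator {0..1} t / sqrt (t * (1 - t))) *\<^sub>R H t) (Beta z w)"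
    unfolding kernel by (rule has_bochner_integral_Beta_complex[OF Re])
  from has_bochner_integral_w_E4[OF b H this]
  have "has_bochner_integral lborel (\<lambda>x. (indicator (E4 b) x * w_E4 b x) *\<^sub>R H (cos_sq p x)) (Beta z w)"
    by (simp only: p_def)
  also have "(\<lambda>x. (indicator (E4 b) x * w_E4 b x) *\<^sub>R H (cos_sq p x))
      = (\<lambda>x. indicator (E4 b) x *\<^sub>R integrand_E4 b n \<mu> x)"
  proof
    fix x
    show "(indicator (E4 b) x * w_E4 b x) *\<^sub>R H (cos_sq p x) = indicator (E4 b) x *\<^sub>R integrand_E4 b n \<mu> x"
    proof (cases "x \<in> E4 b")
      case True
      note sq = cos_phi_E4_squared[OF b True, folded p_def]
      have "complex_of_real (cos_phi_E4 b x) ^ (2 * n) = of_real (cos_sq p x) ^ n"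
        by (simp add: power_mult flip: sq)
      thus ?thesis using True
        by (simp add: integrand_E4_def H_def sq scaleR_conv_of_real)
    qed simp
  qed
  finally have int: "has_bochner_integral lborel (\<lambda>x. indicator (E4 b) x *\<^sub>R integrand_E4 b n \<mu> x) (Beta z w)" .
  have "x \<notin> \<int>\<^sub>\<le>\<^sub>0" if "Re x > 0" for x
  proof
    assume "x \<in> \<int>\<^sub>\<le>\<^sub>0"
    then obtain k where "x = of_int k" "k \<le> 0" by (elim nonpos_Ints_cases)
    with that show False by simp
  qed
  note nonpole = this[of "1 / 2"] this[of "\<mu> + 1"]
  have "pochhammer (1 / 2) n = Gamma z / Gamma (1 / 2 :: complex)"
    using pochhammer_Gamma[of "1 / 2 :: complex" n] nonpole by (simp add: z_def add.commute)
  moreover have "pochhammer (\<mu> + 1) n = Gamma (z + w) / Gamma (\<mu> + 1)"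
    using pochhammer_Gamma[of "\<mu> + 1" n] nonpole assms(1) by (simp add: z_def w_def algebra_simps)
  moreover have "Gamma (1 / 2 :: complex) \<noteq> 0" "Gamma (\<mu> + 1) \<noteq> 0"
    using nonpole assms(1) by (auto simp: Gamma_eq_zero_iff)
  ultimately have "Beta z w = Gamma (1 / 2) * Gamma (\<mu> + 1 / 2) / Gamma (\<mu> + 1)
        * (pochhammer (1 / 2) n / pochhammer (\<mu> + 1) n)"
    by (simp add: Beta_def w_def)
  with int show ?thesis
    by (simp add: has_bochner_integral_iff set_integrable_def set_lebesgue_integral_def)
qed

end
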